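(* Let $(X_n,\ell_n,o_n,\mathcal U_n)$, $n\in\mathbb N$, and $(X,\ell,o,\mathcal U)$, $\mathcal U=(U_k)_{k\in\mathbb N}$, be covered Lorentzian pre-length spaces. If $(X_n,\ell_n,o_n,\mathcal U_n)$ pLGH-converges (resp. strongly pLGH-converges) to $(X,\ell,o,\mathcal U)$, then $(X_n,\ell_n,o_n,\mathcal U_n)$ pLGH-converges (resp. strongly pLGH-converges) to $(X/_\sim,\ell^\sim,\pi(o),(\pi(U_k))_k)$, where $\pi:X\to X/_\sim$ is the quotient map.
   Context: Lorentzian pre-length space: a set $X$ with $\ell:X\times X\to\{-\infty\}\cup[0,\infty]$ satisfying $\ell(x,y)+\ell(y,z)\le\ell(x,z)$ for all $x,y,z$ (convention $-\infty+\infty=\infty+(-\infty)=-\infty$ on the left) and $\ell(x,x)\ge 0$ for all $x$, where $X$ carries a topology finer than (at least as fine as) the one generated by the sub-base of all $I^\pm(x)$. $\tau:=\max(0,\ell)$. $x\ll y$ iff $\ell(x,y)>0$, $x\le y$ iff $\ell(x,y)\ge0$; $I^+(x)=\{y:x\ll y\}$, $I^-(x)=\{y:y\ll x\}$, $J^+(x)=\{y:x\le y\}$, $J^-(x)=\{y:y\le x\}$, $J(x,y)=J^+(x)\cap J^-(y)$. Quotient: $x\sim y$ iff $\ell(x,z)=\ell(y,z)$ and $\ell(z,x)=\ell(z,y)$ for all $z\in X$; $X/_\sim$ carries the quotient topology and $\ell^\sim([x],[y]):=\ell(x,y)$. $\varepsilon$-net for $A\subseteq X$: a collection $S=(J(p_i,q_i))_{i\in\Omega}$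 of causal diamonds with $\tau(p_i,q_i)\le\varepsilon$ and $A\subseteq\bigcup_iJ(p_i,q_i)$ (w.l.o.g. each diamond meets $A$); $V(S)=\{p_i,q_i\}$. A correspondence between sets is a relation projecting onto both factors; its distortion is $\operatorname{dis}(R)=\sup_{(x,y),(x',y')\in R}|\ell(x,x')-\rho(y,y')|$ with $|-\infty-(-\infty)|=0$, $|-\infty-z|=+\infty$ for $z\in\mathbb R$; similarly $\operatorname{dis}(f)$ for a map $f$. LGH-convergence of subsets $A_n\subseteq X_n$ to $A\subseteq X$: for all $\varepsilon>0$ there exist $n_0$ and finite $\varepsilon$-nets $S$ for $A$ in $X$, $S_n$ for $A_n$ in $X_n$ ($n\ge n_0$) such that (1) $|S_n|=|S|$; (2) for $n\ge n_0$ there is a correspondence $R_n$ of $V(S_n)$ and $V(S)$ with $\operatorname{dis}(R_n)\to0$; (3) (extension property) for every $l\ge1$, if $S^l,S^l_n$ are finite $\frac1l$-nets for $A,A_n$ satisfying (1) and (2) with $\varepsilon=\frac1l$ (i.e. $|S^l_n|=|S^l|$ for all large $n$, with correspondences of $V(S^l_n)$ and $V(S^l)$ whose distortions tend to $0$ as $n\to\infty$) and $f^l_n:V(S^l)\to V(S^l_n)$ realizes a correspondence, there is an extension $f^{l+1}_{n'}:V(S^l)\cup V(S^{l+1})\to V(S^l_{n'})\cup V(S^{l+1}_{n'})$ of $f^l_{n'}$ with $\operatorname{dis}(f^{l+1}_{n'})\le\operatorname{dis}(f^l_{n'})$ for some $n'\ge n$; (4) (forward density) with $\mathcal V=\bigcup_{l\ge1}V(S^l)$,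 each $x\in A\setminus\mathcal V$ is a limit of $x_k\in\mathcal V$ with $x_k\le x_{k+1}\le x$. Strong: in (4) one can take $x_k\ll x_{k+1}\ll x$. Covered Lorentzian pre-length space $(X,\ell,o,\mathcal U)$: $o\in X$ and a countable cover $\mathcal U=(U_k)_k$ of $X$ with $U_k\subseteq U_{k+1}$, $o\in U_k$, $\sup_{x,y\in U_k}\tau(x,y)<\infty$. (Strong) pLGH-convergence $(X_n,\ell_n,o_n,\mathcal U_n)\to(X,\ell,o,\mathcal U)$ means $U_{k,n}\to U_k$ (strongly) in the LGH sense for each $k$. *)

theory Defs
  imports "HOL-Analysis.Analysis"
begin

section \<open>Lorentzian pre-length spaces\<close>

text \<open>The underlying set is the topspace of the topology; \<open>ell\<close> is only meaningful on it.\<close>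

record 'a lorentz_space =
  top_of :: "'a topology"
  ell :: "'a \<Rightarrow> 'a \<Rightarrow> ereal"

abbreviation points :: "'a lorentz_space \<Rightarrow> 'a set" where
  "points X \<equiv> topspace (top_of X)"

definition tau :: "'a lorentz_space \<Rightarrow> 'a \<Rightarrow> 'a \<Rightarrow> ereal" where
  "tau X x y = max 0 (ell X x y)"

definition chron :: "'a lorentz_space \<Rightarrow> 'a \<Rightarrow> 'a \<Rightarrow> bool" where
  "chron X x y \<longleftrightarrow> ell X x y > 0"

definition causal :: "'a lorentz_space \<Rightarrow> 'a \<Rightarrow> 'a \<Rightarrow> bool" where
  "causal X x y \<longleftrightarrow> ell X x y \<ge> 0"

definition I_future :: "'a lorentz_space \<Rightarrow> 'a \<Rightarrow> 'a set" where
  "I_future X x = {y \<in> points X. chron X x y}"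

definition I_past :: "'a lorentz_space \<Rightarrow> 'a \<Rightarrow> 'a set" where
  "I_past X x = {y \<in> points X. chron X y x}"

definition J_future :: "'a lorentz_space \<Rightarrow> 'a \<Rightarrow> 'a set" where
  "J_future X x = {y \<in> points X. causal X x y}"

definition J_past :: "'a lorentz_space \<Rightarrow> 'a \<Rightarrow> 'a set" where
  "J_past X x = {y \<in> points X. causal X y x}"

definition diamond :: "'a lorentz_space \<Rightarrow> 'a \<Rightarrow> 'a \<Rightarrow> 'a set" where
  "diamond X p q = J_future X p \<inter> J_past X q"

text \<open>In \<open>ereal\<close>, \<open>\<infinity> + (-\<infinity>) = \<infinity>\<close>; the reverse triangle inequality needs the value \<open>-\<infinity>\<close>.\<close>

definition ladd :: "ereal \<Rightarrow> ereal \<Rightarrow> ereal" where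
  "ladd a b = (if a = -\<infinity> \<or> b = -\<infinity> then -\<infinity> else a + b)"

definition lorentz_pls :: "'a lorentz_space \<Rightarrow> bool" where
  "lorentz_pls X \<longleftrightarrow>
     (\<forall>x\<in>points X. \<forall>y\<in>points X. ell X x y = -\<infinity> \<or> ell X x y \<ge> 0) \<and>
     (\<forall>x\<in>points X. \<forall>y\<in>points X. \<forall>z\<in>points X. ladd (ell X x y) (ell X y z) \<le> ell X x z) \<and>
     (\<forall>x\<in>points X. ell X x x \<ge> 0) \<and>
     (\<forall>U. openin (topology_generated_by
             (insert (points X) (I_future X ` points X \<union> I_past X ` points X))) U
          \<longrightarrow> openin (top_of X) U)"


section \<open>The quotient\<close>

definition indist :: "'a lorentz_space \<Rightarrow> ('a \<times> 'a) set" where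
  "indist X = {(x, y). x \<in> points X \<and> y \<in> points X \<and>
     (\<forall>z\<in>points X. ell X x z = ell X y z \<and> ell X z x = ell X z y)}"

definition qproj :: "'a lorentz_space \<Rightarrow> 'a \<Rightarrow> 'a set" where
  "qproj X x = indist X `` {x}"

definition quot_topology :: "'a lorentz_space \<Rightarrow> 'a set topology" where
  "quot_topology X = topology (\<lambda>V. V \<subseteq> points X // indist X \<and>
     openin (top_of X) {x \<in> points X. qproj X x \<in> V})"

text \<open>\<open>ell\<close> is constant on pairs of classes, see \<open>ell_quot_space\<close> below.\<close>

definition quot_space :: "'a lorentz_space \<Rightarrow> 'a set lorentz_space" where
  "quot_space X = \<lparr> top_of = quot_topology X,
     ell = (\<lambda>a b. the_elem {ell X x y | x y. x \<in> a \<and> y \<in> b}) \<rparr>"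


section \<open>Nets, correspondences and distortion\<close>

text \<open>A finite collection \<open>(J(p\<^sub>i,q\<^sub>i))\<^sub>i\<close> is given by the list of the pairs \<open>(p\<^sub>i,q\<^sub>i)\<close>: it is an
  indexed family, so its cardinality is the length of the list, and its vertices are determined
  by the family (they are not determined by the diamonds as sets).\<close>

definition eps_net :: "'a lorentz_space \<Rightarrow> 'a set \<Rightarrow> real \<Rightarrow> ('a \<times> 'a) list \<Rightarrow> bool" where
  "eps_net X A e S \<longleftrightarrow>
     (\<forall>(p, q) \<in> set S. p \<in> points X \<and> q \<in> points X \<and> tau X p q \<le> ereal e \<and>
                        diamond X p q \<inter> A \<noteq> {}) \<and>
     A \<subseteq> (\<Union>(p, q) \<in> set S. diamond X p q)"

definition vertices :: "('a \<times> 'a) list \<Rightarrow> 'a set" where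
  "vertices S = (\<Union>(p, q) \<in> set S. {p, q})"

definition correspondence :: "('a \<times> 'b) set \<Rightarrow> 'a set \<Rightarrow> 'b set \<Rightarrow> bool" where
  "correspondence R V W \<longleftrightarrow> R \<subseteq> V \<times> W \<and> fst ` R = V \<and> snd ` R = W"

text \<open>The library has \<open>\<infinity> - \<infinity> = \<infinity>\<close> and \<open>-\<infinity> - (-\<infinity>) = \<infinity>\<close>; here equal values are at distance \<open>0\<close>.\<close>

definition ell_dist :: "ereal \<Rightarrow> ereal \<Rightarrow> ereal" where
  "ell_dist a b = (if a = b then 0 else \<bar>a - b\<bar>)"

text \<open>The supremum is taken in \<open>[0,\<infinity>]\<close>, so that the empty relation has distortion \<open>0\<close>.\<close>

definition dis :: "'a lorentz_space \<Rightarrow> 'b lorentz_space \<Rightarrow> ('a \<times> 'b) set \<Rightarrow> ereal" where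
  "dis X Y R = Sup (insert 0 {ell_dist (ell X x x') (ell Y y y') | x y x' y'.
                                 (x, y) \<in> R \<and> (x', y') \<in> R})"

definition graph_on :: "'a set \<Rightarrow> ('a \<Rightarrow> 'b) \<Rightarrow> ('a \<times> 'b) set" where
  "graph_on V f = {(x, f x) | x. x \<in> V}"


section \<open>Lorentzian Gromov-Hausdorff convergence\<close>

text \<open>\<open>S, T\<close> are the nets at one level, \<open>S', T'\<close> those at the next one. As \<open>f\<close> is a family
  of maps given for all large \<open>n\<close>, and arbitrarily large \<open>n'\<close> are required, the values of
  \<open>T\<close>, \<open>T'\<close> and \<open>f\<close> at small indices are irrelevant.\<close>

definition extension_property ::
  "(nat \<Rightarrow> 'b lorentz_space) \<Rightarrow> 'a lorentz_space \<Rightarrow>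
   ('a \<times> 'a) list \<Rightarrow> (nat \<Rightarrow> ('b \<times> 'b) list) \<Rightarrow>
   ('a \<times> 'a) list \<Rightarrow> (nat \<Rightarrow> ('b \<times> 'b) list) \<Rightarrow> bool" where
  "extension_property Y X S T S' T' \<longleftrightarrow>
     (\<forall>f. (\<forall>\<^sub>F n in sequentially.
              correspondence (graph_on (vertices S) (f n)) (vertices S) (vertices (T n))) \<longrightarrow>
        (\<forall>n. \<exists>n'\<ge>n. \<exists>g.
            (\<forall>x\<in>vertices S. g x = f n' x) \<and>
            g ` (vertices S \<union> vertices S') \<subseteq> vertices (T n') \<union> vertices (T' n') \<and>
            dis X (Y n') (graph_on (vertices S \<union> vertices S') g)
              \<le> dis X (Y n') (graph_on (vertices S) (f n'))))"

definition forward_dense ::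
  "'a lorentz_space \<Rightarrow> ('a \<Rightarrow> 'a \<Rightarrow> bool) \<Rightarrow> 'a set \<Rightarrow> 'a set \<Rightarrow> bool" where
  "forward_dense X r A V \<longleftrightarrow>
     (\<forall>x\<in>A - V. \<exists>xs :: nat \<Rightarrow> 'a.
        (\<forall>k. xs k \<in> V \<and> r (xs k) (xs (Suc k)) \<and> r (xs (Suc k)) x) \<and>
        limitin (top_of X) xs x sequentially)"

text \<open>\<open>S e\<close> and \<open>T e n\<close> are the nets that exist for a given \<open>e\<close>; they are chosen simultaneously
  for all \<open>e > 0\<close>, because the extension property and forward density relate the nets
  \<open>S (1/l)\<close> and \<open>T (1/l) n\<close> for different \<open>l\<close>. The parameter \<open>r\<close> is the relation used in
  forward density.\<close>

definition LGH_conv_by ::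
  "('a \<Rightarrow> 'a \<Rightarrow> bool) \<Rightarrow> (nat \<Rightarrow> 'b lorentz_space) \<Rightarrow> (nat \<Rightarrow> 'b set) \<Rightarrow>
   'a lorentz_space \<Rightarrow> 'a set \<Rightarrow> bool" where
  "LGH_conv_by r Y B X A \<longleftrightarrow>
     (\<exists>(S :: real \<Rightarrow> ('a \<times> 'a) list) (T :: real \<Rightarrow> nat \<Rightarrow> ('b \<times> 'b) list).
        (\<forall>e>0. eps_net X A e (S e) \<and>
           (\<exists>n0. (\<forall>n\<ge>n0. eps_net (Y n) (B n) e (T e n)) \<and>
                 (\<forall>n\<ge>n0. length (T e n) = length (S e)) \<and>
                 (\<exists>R. (\<forall>n\<ge>n0. correspondence (R n) (vertices (T e n)) (vertices (S e))) \<and>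
                      (\<lambda>n. dis (Y n) X (R n)) \<longlonglongrightarrow> 0))) \<and>
        (\<forall>l::nat. l \<ge> 1 \<longrightarrow> extension_property Y X
             (S (1 / real l)) (T (1 / real l)) (S (1 / real (l + 1))) (T (1 / real (l + 1)))) \<and>
        forward_dense X r A (\<Union>l\<in>{1::nat..}. vertices (S (1 / real l))))"

definition LGH_conv where
  "LGH_conv Y B X A \<longleftrightarrow> LGH_conv_by (causal X) Y B X A"

definition strong_LGH_conv where
  "strong_LGH_conv Y B X A \<longleftrightarrow> LGH_conv_by (chron X) Y B X A"


section \<open>Covered spaces and pointed convergence\<close>

record 'a covered_space =
  space_of :: "'a lorentz_space"
  base :: 'a
  cover :: "nat \<Rightarrow> 'a set"

definition covered_lorentz_pls :: "'a covered_space \<Rightarrow> bool" where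
  "covered_lorentz_pls C \<longleftrightarrow>
     lorentz_pls (space_of C) \<and>
     base C \<in> points (space_of C) \<and>
     (\<Union>k. cover C k) = points (space_of C) \<and>
     (\<forall>k. cover C k \<subseteq> cover C (Suc k)) \<and>
     (\<forall>k. base C \<in> cover C k) \<and>
     (\<forall>k. (SUP (x, y) \<in> cover C k \<times> cover C k. tau (space_of C) x y) < \<infinity>)"

definition pLGH_conv :: "(nat \<Rightarrow> 'b covered_space) \<Rightarrow> 'a covered_space \<Rightarrow> bool" where
  "pLGH_conv D C \<longleftrightarrow>
     (\<forall>k. LGH_conv (\<lambda>n. space_of (D n)) (\<lambda>n. cover (D n) k) (space_of C) (cover C k))"

definition strong_pLGH_conv :: "(nat \<Rightarrow> 'b covered_space) \<Rightarrow> 'a covered_space \<Rightarrow> bool" where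
  "strong_pLGH_conv D C \<longleftrightarrow>
     (\<forall>k. strong_LGH_conv (\<lambda>n. space_of (D n)) (\<lambda>n. cover (D n) k) (space_of C) (cover C k))"

definition quot_covered :: "'a covered_space \<Rightarrow> 'a set covered_space" where
  "quot_covered C = \<lparr> space_of = quot_space (space_of C),
     base = qproj (space_of C) (base C),
     cover = (\<lambda>k. qproj (space_of C) ` cover C k) \<rparr>"


section \<open>The quotient of a covered space is a covered space\<close>

lemma equiv_indist: "equiv (points X) (indist X)"
  by (rule equivI) (auto simp: indist_def refl_on_def sym_def trans_def)

lemma qproj_self: "x \<in> points X \<Longrightarrow> x \<in> qproj X x"
  by (auto simp: qproj_def indist_def)

lemma qproj_quotient: "x \<in> points X \<Longrightarrow> qproj X x \<in> points X // indist X"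
  by (auto simp: qproj_def quotient_def)

lemma qproj_image: "qproj X ` points X = points X // indist X"
  by (auto simp: qproj_def quotient_def)

lemma istopology_quot:
  "istopology (\<lambda>V. V \<subseteq> points X // indist X \<and>
     openin (top_of X) {x \<in> points X. qproj X x \<in> V})"
proof -
  have "openin (top_of X) {x \<in> points X. qproj X x \<in> \<Union>K}"
    if "\<forall>V\<in>K. openin (top_of X) {x \<in> points X. qproj X x \<in> V}" for K
  proof -
    have "{x \<in> points X. qproj X x \<in> \<Union>K} = (\<Union>V\<in>K. {x \<in> points X. qproj X x \<in> V})" by auto
    then show ?thesis using that by auto
  qed
  moreover have "openin (top_of X) {x \<in> points X. qproj X x \<in> V \<inter> W}"
    if "openin (top_of X) {x \<in> points X. qproj X x \<in> V}"
       "openin (top_of X) {x \<in> points X. qproj X x \<in> W}" for V W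
  proof -
    have "{x \<in> points X. qproj X x \<in> V \<inter> W} =
        {x \<in> points X. qproj X x \<in> V} \<inter> {x \<in> points X. qproj X x \<in> W}" by auto
    then show ?thesis using that by auto
  qed
  ultimately show ?thesis
    unfolding istopology_def by (simp add: le_infI1 Sup_le_iff)
qed

lemma openin_quot_space:
  "openin (top_of (quot_space X)) V \<longleftrightarrow> V \<subseteq> points X // indist X \<and>
     openin (top_of X) {x \<in> points X. qproj X x \<in> V}"
  unfolding quot_space_def quot_topology_def
  using topology_inverse'[OF istopology_quot[of X]] by simp

lemma points_quot_space: "points (quot_space X) = points X // indist X"
proof -
  have "{x \<in> points X. qproj X x \<in> points X // indist X} = points X"
    using qproj_quotient by auto
  then have "openin (top_of (quot_space X)) (points X // indist X)"
    by (simp add: openin_quot_space)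
  moreover have "V \<subseteq> points X // indist X" if "openin (top_of (quot_space X)) V" for V
    using that openin_quot_space by blast
  ultimately show ?thesis
    by (meson openin_subset openin_topspace subset_antisym)
qed

lemma quotient_map_qproj: "quotient_map (top_of X) (top_of (quot_space X)) (qproj X)"
  unfolding quotient_map_def
  by (auto simp: points_quot_space qproj_image openin_quot_space)

lemma ell_quot_space:
  assumes "x \<in> points X" "y \<in> points X"
  shows "ell (quot_space X) (qproj X x) (qproj X y) = ell X x y"
proof -
  have "ell X x' y' = ell X x y" if "x' \<in> qproj X x" "y' \<in> qproj X y" for x' y'
    using that assms unfolding qproj_def indist_def by auto
  then have "{ell X x' y' | x' y'. x' \<in> qproj X x \<and> y' \<in> qproj X y} = {ell X x y}"
    using qproj_self[OF assms(1)] qproj_self[OF assms(2)] by blast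
  then show ?thesis by (simp add: quot_space_def)
qed

lemma lorentz_pls_open:
  "(\<forall>U. openin (topology_generated_by
             (insert (points X) (I_future X ` points X \<union> I_past X ` points X))) U
          \<longrightarrow> openin (top_of X) U) \<longleftrightarrow>
   (\<forall>x\<in>points X. openin (top_of X) (I_future X x) \<and> openin (top_of X) (I_past X x))"
  (is "?L \<longleftrightarrow> ?R")
proof
  show "?L \<Longrightarrow> ?R" by (auto simp: topology_generated_by_Basis)
next
  assume R: ?R
  show ?L
  proof (intro allI impI)
    fix U
    assume "openin (topology_generated_by
             (insert (points X) (I_future X ` points X \<union> I_past X ` points X))) U"
    then have "generate_topology_on
             (insert (points X) (I_future X ` points X \<union> I_past X ` points X)) U"
      by (rule openin_topology_generated_by)
    then show "openin (top_of X) U"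
      by induct (use R in auto)
  qed
qed

lemma lorentz_pls_quot_space:
  assumes "lorentz_pls X"
  shows "lorentz_pls (quot_space X)"
proof -
  have pts: "points (quot_space X) = qproj X ` points X"
    by (simp add: points_quot_space qproj_image)
  have F: "openin (top_of (quot_space X)) (I_future (quot_space X) (qproj X x))"
    and P: "openin (top_of (quot_space X)) (I_past (quot_space X) (qproj X x))"
    if "x \<in> points X" for x
  proof -
    have "{y \<in> points X. qproj X y \<in> I_future (quot_space X) (qproj X x)} = I_future X x"
      "{y \<in> points X. qproj X y \<in> I_past (quot_space X) (qproj X x)} = I_past X x"
      using that by (auto simp: I_future_def I_past_def chron_def ell_quot_space pts)
    moreover have "openin (top_of X) (I_future X x)" "openin (top_of X) (I_past X x)"
      using assms that unfolding lorentz_pls_def lorentz_pls_open by auto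
    ultimately show "openin (top_of (quot_space X)) (I_future (quot_space X) (qproj X x))"
      "openin (top_of (quot_space X)) (I_past (quot_space X) (qproj X x))"
      unfolding openin_quot_space by (auto simp: I_future_def I_past_def points_quot_space)
  qed
  show ?thesis
    using assms F P unfolding lorentz_pls_def lorentz_pls_open
    by (simp add: pts ell_quot_space)
qed

lemma covered_lorentz_pls_quot_covered:
  assumes "covered_lorentz_pls C"
  shows "covered_lorentz_pls (quot_covered C)"
proof -
  let ?X = "space_of C"
  have sub: "cover C k \<subseteq> points ?X" for k
    using assms unfolding covered_lorentz_pls_def by blast
  have "(\<lambda>(a, b). tau (quot_space ?X) a b) ` (qproj ?X ` cover C k \<times> qproj ?X ` cover C k) =
      (\<lambda>(x, y). tau ?X x y) ` (cover C k \<times> cover C k)" for k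
  proof -
    have "tau (quot_space ?X) (qproj ?X x) (qproj ?X y) = tau ?X x y"
      if "x \<in> cover C k" "y \<in> cover C k" for x y
      using that sub by (simp add: tau_def ell_quot_space subset_iff)
    then show ?thesis by (force simp: image_iff)
  qed
  moreover have "(\<Union>k. qproj ?X ` cover C k) = qproj ?X ` points ?X"
    using assms unfolding covered_lorentz_pls_def by blast
  moreover have "qproj ?X ` cover C k \<subseteq> qproj ?X ` cover C (Suc k)" for k
    using assms unfolding covered_lorentz_pls_def by (simp add: image_mono)
  ultimately show ?thesis
    using assms unfolding covered_lorentz_pls_def quot_covered_def
    by (simp add: lorentz_pls_quot_space points_quot_space qproj_image[symmetric])
qed

end

theory Submission
  imports Defs
begin

text \<open>
  The conditions defining LGH convergence see the limit space only through the values of \<open>ell\<close> on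
  pairs of points and, in forward density, through the convergence of sequences.
  The quotient map preserves \<open>ell\<close> and is continuous, and these two properties alone suffice: the limit may be replaced by its image under any such map \<open>\<pi> : X \<rightarrow> Z\<close>
  (\<open>LGH_conv_by_push\<close>).

  Nets, correspondences and approximating sequences are simply pushed forward along \<open>\<pi>\<close>. The
  extension property runs against this direction, because it starts from a map \<open>f\<close> on the vertices
  of the \<^emph>\<open>image\<close> net. Composing \<open>f\<close> with \<open>\<pi>\<close> gives a map of no larger distortion on the
  original vertices, which extends by hypothesis to a map \<open>g\<close>. Now \<open>g\<close> need not be constant on the
  fibres of \<open>\<pi>\<close>, so it does not descend; but composing it with a section of \<open>\<pi>\<close> does give a map on
  the image vertices, and its distortion is at most that of \<open>g\<close>. The only care needed is that the
  section selects old vertices whenever it can, for then the new map agrees with \<open>f\<close> where it must.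
\<close>

definition ell_preserving :: "'a lorentz_space \<Rightarrow> 'c lorentz_space \<Rightarrow> ('a \<Rightarrow> 'c) \<Rightarrow> bool" where
  "ell_preserving X Z p \<longleftrightarrow> p ` points X \<subseteq> points Z \<and>
     (\<forall>x\<in>points X. \<forall>y\<in>points X. ell Z (p x) (p y) = ell X x y)"

abbreviation push_net :: "('a \<Rightarrow> 'c) \<Rightarrow> ('a \<times> 'a) list \<Rightarrow> ('c \<times> 'c) list" where
  "push_net p \<equiv> map (map_prod p p)"

lemma ell_preservingD:
  assumes "ell_preserving X Z p" "x \<in> points X"
  shows "p x \<in> points Z"
    and "y \<in> points X \<Longrightarrow> ell Z (p x) (p y) = ell X x y"
  using assms unfolding ell_preserving_def by auto

lemma ell_preserving_qproj: "ell_preserving X (quot_space X) (qproj X)"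
  unfolding ell_preserving_def by (auto simp: points_quot_space qproj_quotient ell_quot_space)


section \<open>Nets and correspondences under maps preserving \<open>ell\<close>\<close>

lemma vertices_push_net: "vertices (push_net p S) = p ` vertices S"
  unfolding vertices_def by force

lemma eps_net_vertices_subset: "eps_net X A e S \<Longrightarrow> vertices S \<subseteq> points X"
  unfolding eps_net_def vertices_def by auto

lemma diamond_push:
  assumes "ell_preserving X Z p" "a \<in> points X" "b \<in> points X"
  shows "p ` diamond X a b \<subseteq> diamond Z (p a) (p b)"
  using assms unfolding diamond_def J_future_def J_past_def causal_def
  by (auto simp: ell_preservingD)

text \<open>Diamonds of \<open>Z\<close> may be larger than the images of diamonds of \<open>X\<close>. This does no harm, since a
  net only asks that its diamonds cover and meet the given set.\<close>

lemma eps_net_push: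
  assumes p: "ell_preserving X Z p" and S: "eps_net X A e S"
  shows "eps_net Z (p ` A) e (push_net p S)"
  unfolding eps_net_def
proof (intro conjI ballI, clarify)
  fix c d assume "(c, d) \<in> set (push_net p S)"
  then obtain a b where ab: "(a, b) \<in> set S" and cd: "c = p a" "d = p b" by auto
  have pts: "a \<in> points X" "b \<in> points X"
    and "tau X a b \<le> ereal e" "diamond X a b \<inter> A \<noteq> {}"
    using S ab unfolding eps_net_def by auto
  with diamond_push[OF p pts]
  show "c \<in> points Z \<and> d \<in> points Z \<and> tau Z c d \<le> ereal e \<and> diamond Z c d \<inter> p ` A \<noteq> {}"
    using p by (auto simp: cd tau_def ell_preservingD)
next
  show "p ` A \<subseteq> (\<Union>(c, d)\<in>set (push_net p S). diamond Z c d)"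
  proof clarify
    fix x assume "x \<in> A"
    then obtain a b where ab: "(a, b) \<in> set S" "x \<in> diamond X a b"
      using S unfolding eps_net_def by auto
    then have "a \<in> points X" "b \<in> points X" using S unfolding eps_net_def by auto
    then have "p x \<in> diamond Z (p a) (p b)" using diamond_push[OF p] ab by blast
    then show "p x \<in> (\<Union>(c, d)\<in>set (push_net p S). diamond Z c d)" using ab(1) by force
  qed
qed

lemma correspondence_push:
  "correspondence R V W \<Longrightarrow> correspondence (map_prod id p ` R) V (p ` W)"
  unfolding correspondence_def by (force simp: image_image)

lemma correspondence_graph_on: "correspondence (graph_on V f) V W \<longleftrightarrow> f ` V = W"
  unfolding correspondence_def graph_on_def by force


section \<open>Distortion under maps preserving \<open>ell\<close>\<close>

text \<open>Transport of pairs is stated as a relation, so that it serves both for images of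
  correspondences and for maps composed with a section, where only some pairs are hit.\<close>

lemma dis_mono_transport:
  assumes "\<And>x y x' y'. (x, y) \<in> R \<Longrightarrow> (x', y') \<in> R \<Longrightarrow>
      \<exists>a b a' b'. (a, b) \<in> Q \<and> (a', b') \<in> Q \<and>
        ell X x x' = ell X' a a' \<and> ell Y y y' = ell Y' b b'"
  shows "dis X Y R \<le> dis X' Y' Q"
  unfolding dis_def by (rule Sup_subset_mono) (use assms in fastforce)

lemma dis_push_right_le:
  assumes "ell_preserving X Z p" "snd ` R \<subseteq> points X"
  shows "dis Y Z (map_prod id p ` R) \<le> dis Y X R"
proof (rule dis_mono_transport)
  fix x y x' y'
  assume "(x, y) \<in> map_prod id p ` R" "(x', y') \<in> map_prod id p ` R"
  then obtain v w where vw: "(x, v) \<in> R" "(x', w) \<in> R" "y = p v" "y' = p w" by auto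
  then have "v \<in> points X" "w \<in> points X" using assms(2) by force+
  then show "\<exists>a b a' b'. (a, b) \<in> R \<and> (a', b') \<in> R \<and>
        ell Y x x' = ell Y a a' \<and> ell Z y y' = ell X b b'"
    using vw ell_preservingD(2)[OF assms(1)] by blast
qed

lemma dis_nonneg: "0 \<le> dis X Y R"
  unfolding dis_def by (rule Sup_upper) simp

text \<open>A point of \<open>p ` V\<close> is the image of its representative \<open>s c\<close>, so pulling back along the
  section \<open>s\<close> only forgets pairs.\<close>

lemma dis_graph_section_le:
  assumes "ell_preserving X Z p" "V \<subseteq> points X"
    and s: "\<And>c. c \<in> p ` V \<Longrightarrow> s c \<in> V \<and> p (s c) = c"
  shows "dis Z Y (graph_on (p ` V) (g \<circ> s)) \<le> dis X Y (graph_on V g)"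
proof (rule dis_mono_transport)
  fix c y c' y'
  assume "(c, y) \<in> graph_on (p ` V) (g \<circ> s)" "(c', y') \<in> graph_on (p ` V) (g \<circ> s)"
  then have c: "c \<in> p ` V" "y = g (s c)" and c': "c' \<in> p ` V" "y' = g (s c')"
    by (auto simp: graph_on_def)
  have "ell Z c c' = ell X (s c) (s c')"
    using s[OF c(1)] s[OF c'(1)] ell_preservingD(2)[OF assms(1)] assms(2) by (metis subsetD)
  then show "\<exists>a b a' b'. (a, b) \<in> graph_on V g \<and> (a', b') \<in> graph_on V g \<and>
        ell Z c c' = ell X a a' \<and> ell Y y y' = ell Y b b'"
    using s[OF c(1)] s[OF c'(1)] c(2) c'(2) unfolding graph_on_def by blast
qed

lemma dis_graph_comp_le:
  assumes "ell_preserving X Z p" "V \<subseteq> points X"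
  shows "dis X Y (graph_on V (f \<circ> p)) \<le> dis Z Y (graph_on (p ` V) f)"
proof (rule dis_mono_transport)
  fix x y x' y'
  assume "(x, y) \<in> graph_on V (f \<circ> p)" "(x', y') \<in> graph_on V (f \<circ> p)"
  then have "x \<in> V" "x' \<in> V" "y = f (p x)" "y' = f (p x')" by (auto simp: graph_on_def)
  moreover from this have "ell X x x' = ell Z (p x) (p x')"
    using ell_preservingD(2)[OF assms(1)] assms(2) by (metis subsetD)
  ultimately show "\<exists>a b a' b'. (a, b) \<in> graph_on (p ` V) f \<and> (a', b') \<in> graph_on (p ` V) f \<and>
        ell X x x' = ell Z a a' \<and> ell Y y y' = ell Y b b'"
    unfolding graph_on_def by blast
qed


section \<open>The extension property\<close>

lemma section_preferring_subset:
  obtains s where "\<And>c. c \<in> p ` (V \<union> W) \<Longrightarrow> s c \<in> V \<union> W \<and> p (s c) = c"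
    and "\<And>c. c \<in> p ` V \<Longrightarrow> s c \<in> V"
proof
  let ?s = "\<lambda>c. if c \<in> p ` V then inv_into V p c else inv_into W p c"
  show "?s c \<in> V \<union> W \<and> p (?s c) = c" if "c \<in> p ` (V \<union> W)" for c
    using that by (auto simp: image_Un inv_into_into f_inv_into_f)
  show "?s c \<in> V" if "c \<in> p ` V" for c
    using that by (auto simp: inv_into_into)
qed

text \<open>For \<open>f\<close> on the image vertices, let \<open>g\<close> extend \<open>f \<circ> p\<close>, and let \<open>s\<close> be a section of \<open>p\<close> with
  values in the old vertices where possible. Then \<open>g \<circ> s\<close> extends \<open>f\<close>, since \<open>g (s c) = f (p (s c))\<close>
  on old vertices, and both changes between \<open>X\<close> and \<open>Z\<close> are distortion-nonincreasing.\<close>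

lemma extension_property_push:
  assumes p: "ell_preserving X Z p"
    and V: "vertices S \<subseteq> points X" "vertices S' \<subseteq> points X"
    and ext: "extension_property Y X S T S' T'"
  shows "extension_property Y Z (push_net p S) T (push_net p S') T'"
  unfolding extension_property_def vertices_push_net correspondence_graph_on
proof (intro allI impI)
  fix f n
  assume f: "\<forall>\<^sub>F n in sequentially. f n ` p ` vertices S = vertices (T n)"
  have "\<forall>\<^sub>F n in sequentially. (f n \<circ> p) ` vertices S = vertices (T n)"
    using f by (simp add: image_comp)
  then obtain n' g where n': "n' \<ge> n"
    and g: "\<forall>x\<in>vertices S. g x = f n' (p x)"
      "g ` (vertices S \<union> vertices S') \<subseteq> vertices (T n') \<union> vertices (T' n')"
      "dis X (Y n') (graph_on (vertices S \<union> vertices S') g)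
         \<le> dis X (Y n') (graph_on (vertices S) (f n' \<circ> p))"
    using ext[unfolded extension_property_def correspondence_graph_on,
        rule_format, of "\<lambda>n. f n \<circ> p" n] by (auto simp: comp_def)
  obtain s where s: "\<And>c. c \<in> p ` (vertices S \<union> vertices S') \<Longrightarrow>
        s c \<in> vertices S \<union> vertices S' \<and> p (s c) = c"
      "\<And>c. c \<in> p ` vertices S \<Longrightarrow> s c \<in> vertices S"
    using section_preferring_subset[of p "vertices S" "vertices S'"] by blast
  show "\<exists>n'\<ge>n. \<exists>h. (\<forall>c\<in>p ` vertices S. h c = f n' c) \<and>
      h ` (p ` vertices S \<union> p ` vertices S') \<subseteq> vertices (T n') \<union> vertices (T' n') \<and>
      dis Z (Y n') (graph_on (p ` vertices S \<union> p ` vertices S') h)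
        \<le> dis Z (Y n') (graph_on (p ` vertices S) (f n'))"
  proof (intro exI conjI)
    show "\<forall>c\<in>p ` vertices S. (g \<circ> s) c = f n' c"
    proof
      fix c assume c: "c \<in> p ` vertices S"
      then have "p (s c) = c" using s(1) by blast
      then show "(g \<circ> s) c = f n' c" using s(2)[OF c] g(1) by simp
    qed
    show "(g \<circ> s) ` (p ` vertices S \<union> p ` vertices S') \<subseteq> vertices (T n') \<union> vertices (T' n')"
      using s(1) g(2) unfolding image_Un[symmetric] by fastforce
    have "dis Z (Y n') (graph_on (p ` (vertices S \<union> vertices S')) (g \<circ> s))
        \<le> dis X (Y n') (graph_on (vertices S \<union> vertices S') g)"
      by (rule dis_graph_section_le[OF p]) (use V s(1) in auto)
    also note g(3)
    also have "dis X (Y n') (graph_on (vertices S) (f n' \<circ> p))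
        \<le> dis Z (Y n') (graph_on (p ` vertices S) (f n'))"
      by (rule dis_graph_comp_le[OF p V(1)])
    finally show "dis Z (Y n') (graph_on (p ` vertices S \<union> p ` vertices S') (g \<circ> s))
        \<le> dis Z (Y n') (graph_on (p ` vertices S) (f n'))"
      by (simp add: image_Un)
  qed (rule n')
qed


section \<open>Pushing LGH limits forward\<close>

lemma forward_dense_push:
  assumes p: "continuous_map (top_of X) (top_of Z) p"
    and r: "\<And>x y. x \<in> points X \<Longrightarrow> y \<in> points X \<Longrightarrow> r x y \<Longrightarrow> r' (p x) (p y)"
    and AV: "A \<subseteq> points X" "V \<subseteq> points X"
    and dense: "forward_dense X r A V"
  shows "forward_dense Z r' (p ` A) (p ` V)"
  unfolding forward_dense_def
proof
  fix c assume "c \<in> p ` A - p ` V"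
  then obtain x where x: "x \<in> A - V" "c = p x" by auto
  then obtain xs where xs: "\<And>k. xs k \<in> V \<and> r (xs k) (xs (Suc k)) \<and> r (xs (Suc k)) x"
      "limitin (top_of X) xs x sequentially"
    using dense unfolding forward_dense_def by blast
  have "limitin (top_of Z) (p \<circ> xs) c sequentially"
    using continuous_map_limit[OF p xs(2)] x(2) by (simp add: comp_def)
  moreover have "(p \<circ> xs) k \<in> p ` V \<and> r' ((p \<circ> xs) k) ((p \<circ> xs) (Suc k)) \<and>
      r' ((p \<circ> xs) (Suc k)) c" for k
    using xs(1)[of k] xs(1)[of "Suc k"] r AV x by (auto simp: subset_iff)
  ultimately show "\<exists>xs. (\<forall>k. xs k \<in> p ` V \<and> r' (xs k) (xs (Suc k)) \<and> r' (xs (Suc k)) c) \<and>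
      limitin (top_of Z) xs c sequentially"
    by blast
qed

text \<open>The nets for the approximating spaces are kept, and those for the limit are pushed forward
  as indexed families. Vertices or diamonds identified by \<open>p\<close> therefore do not change the number
  of diamonds of the net.\<close>

lemma LGH_conv_by_push:
  assumes p: "ell_preserving X Z p"
    and cont: "continuous_map (top_of X) (top_of Z) p"
    and r: "\<And>x y. x \<in> points X \<Longrightarrow> y \<in> points X \<Longrightarrow> r x y \<Longrightarrow> r' (p x) (p y)"
    and A: "A \<subseteq> points X"
    and conv: "LGH_conv_by r Y B X A"
  shows "LGH_conv_by r' Y B Z (p ` A)"
proof -
  obtain S T where approx: "\<forall>e>0. eps_net X A e (S e) \<and>
        (\<exists>n0. (\<forall>n\<ge>n0. eps_net (Y n) (B n) e (T e n)) \<and>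
           (\<forall>n\<ge>n0. length (T e n) = length (S e)) \<and>
           (\<exists>R. (\<forall>n\<ge>n0. correspondence (R n) (vertices (T e n)) (vertices (S e))) \<and>
                (\<lambda>n. dis (Y n) X (R n)) \<longlonglongrightarrow> 0))"
    and ext: "\<forall>l::nat. l \<ge> 1 \<longrightarrow> extension_property Y X
        (S (1 / real l)) (T (1 / real l)) (S (1 / real (l + 1))) (T (1 / real (l + 1)))"
    and dense: "forward_dense X r A (\<Union>l\<in>{1::nat..}. vertices (S (1 / real l)))"
    using conv unfolding LGH_conv_by_def by (elim exE conjE) (rule that)
  have net: "eps_net X A e (S e)" if "e > 0" for e
    using approx that by blast
  have V: "vertices (S e) \<subseteq> points X" if "e > 0" for e
    using eps_net_vertices_subset[OF net[OF that]] .
  have approx': "\<exists>n0. (\<forall>n\<ge>n0. eps_net (Y n) (B n) e (T e n)) \<and>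
        (\<forall>n\<ge>n0. length (T e n) = length (push_net p (S e))) \<and>
        (\<exists>R. (\<forall>n\<ge>n0. correspondence (R n) (vertices (T e n)) (vertices (push_net p (S e)))) \<and>
             (\<lambda>n. dis (Y n) Z (R n)) \<longlonglongrightarrow> 0)" if e: "e > 0" for e
  proof -
    obtain n0 R where n0: "\<forall>n\<ge>n0. eps_net (Y n) (B n) e (T e n)"
        "\<forall>n\<ge>n0. length (T e n) = length (S e)"
      and R: "\<And>n. n \<ge> n0 \<Longrightarrow> correspondence (R n) (vertices (T e n)) (vertices (S e))"
        "(\<lambda>n. dis (Y n) X (R n)) \<longlonglongrightarrow> 0"
      using approx[rule_format, OF e] by blast
    have le: "dis (Y n) Z (map_prod id p ` R n) \<le> dis (Y n) X (R n)" if "n \<ge> n0" for n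
      using R(1)[OF that] V[OF e] unfolding correspondence_def
      by (intro dis_push_right_le[OF p]) auto
    have "(\<lambda>n. dis (Y n) Z (map_prod id p ` R n)) \<longlonglongrightarrow> 0"
    proof (rule tendsto_sandwich[OF _ _ tendsto_const R(2)])
      show "\<forall>\<^sub>F n in sequentially. dis (Y n) Z (map_prod id p ` R n) \<le> dis (Y n) X (R n)"
        using le by (auto simp: eventually_sequentially)
    qed (simp add: dis_nonneg)
    moreover have "\<forall>n\<ge>n0. correspondence (map_prod id p ` R n) (vertices (T e n))
        (vertices (push_net p (S e)))"
      unfolding vertices_push_net by (intro allI impI correspondence_push R(1))
    ultimately show ?thesis
      using n0 by (intro exI[of _ n0] exI[of _ "\<lambda>n. map_prod id p ` R n"] conjI) simp_all
  qed
  have ext': "extension_property Y Z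
        (push_net p (S (1 / real l))) (T (1 / real l))
        (push_net p (S (1 / real (l + 1)))) (T (1 / real (l + 1)))" if "l \<ge> 1" for l :: nat
    using that by (intro extension_property_push[OF p _ _ ext[rule_format]] V) auto
  have "forward_dense Z r' (p ` A) (p ` (\<Union>l\<in>{1::nat..}. vertices (S (1 / real l))))"
  proof (rule forward_dense_push[OF cont _ A _ dense])
    show "(\<Union>l\<in>{1::nat..}. vertices (S (1 / real l))) \<subseteq> points X"
      using V by (intro UN_least) simp
  qed (rule r)
  then have dense': "forward_dense Z r' (p ` A)
      (\<Union>l\<in>{1::nat..}. vertices (push_net p (S (1 / real l))))"
    by (simp add: image_UN vertices_push_net)
  show ?thesis
    unfolding LGH_conv_by_def
    by (rule exI[of _ "\<lambda>e. push_net p (S e)"], rule exI[of _ T])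
      (intro conjI allI impI eps_net_push[OF p net] approx' ext' dense')
qed

theorem theorem5p3:
  fixes D :: "nat \<Rightarrow> 'b covered_space" and C :: "'a covered_space"
  assumes "\<And>n. covered_lorentz_pls (D n)"
    and "covered_lorentz_pls C"
  shows "(pLGH_conv D C \<longrightarrow> pLGH_conv D (quot_covered C)) \<and>
         (strong_pLGH_conv D C \<longrightarrow> strong_pLGH_conv D (quot_covered C))"
proof -
  let ?X = "space_of C"
  let ?Z = "quot_space ?X"
  have A: "cover C k \<subseteq> points ?X" for k
    using assms(2) unfolding covered_lorentz_pls_def by blast
  note push = LGH_conv_by_push[OF ell_preserving_qproj
      quotient_imp_continuous_map[OF quotient_map_qproj] _ A]
  have "LGH_conv_by (causal ?Z) Y B ?Z (qproj ?X ` cover C k)"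
    if "LGH_conv_by (causal ?X) Y B ?X (cover C k)"
    for k and Y :: "nat \<Rightarrow> 'b lorentz_space" and B
    by (rule push[OF _ that]) (simp add: causal_def ell_quot_space)
  moreover have "LGH_conv_by (chron ?Z) Y B ?Z (qproj ?X ` cover C k)"
    if "LGH_conv_by (chron ?X) Y B ?X (cover C k)"
    for k and Y :: "nat \<Rightarrow> 'b lorentz_space" and B
    by (rule push[OF _ that]) (simp add: chron_def ell_quot_space)
  ultimately show ?thesis
    unfolding pLGH_conv_def strong_pLGH_conv_def LGH_conv_def strong_LGH_conv_def
    by (simp add: quot_covered_def)
qed

end
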